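(* Let $h\geq 1$ be an integer and let $A$ be a finite set of $k$ integers containing both positive and negative integers. Then \[|h_{\pm}A| \geq hk-h+1.\] This lower bound is best possible: for every odd integer $k\geq 3$, the set $A=\{-\tfrac{k-1}{2},\ldots,-1,0,1,\ldots,\tfrac{k-1}{2}\}$ satisfies $|h_{\pm}A|=hk-h+1$.
   Context: For a finite set $A=\{a_0,a_1,\ldots,a_{k-1}\}$ of integers and a positive integer $h$, the $h$-fold signed sumset of $A$ is \[h_{\pm}A=\Big\{\sum_{i=0}^{k-1}\lambda_i a_i : (\lambda_0,\ldots,\lambda_{k-1})\in\mathbb{Z}^k,\ \sum_{i=0}^{k-1}|\lambda_i|=h\Big\}.\] *)

theory Defs
  imports Main
begin

text \<open>
  The coefficient vector is indexed by the elements of \<open>A\<close> themselves rather than by an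
  enumeration of them; only the values of \<open>c\<close> on \<open>A\<close> matter.
\<close>

definition signed_sumset :: "nat \<Rightarrow> int set \<Rightarrow> int set" where
  "signed_sumset h A =
     {\<Sum>a\<in>A. c a * a | c :: int \<Rightarrow> int. (\<Sum>a\<in>A. \<bar>c a\<bar>) = int h}"

end

theory Submission
  imports Defs "HOL-Library.Set_Algebras"
begin

text \<open>
  Restricting to nonnegative coefficients shows that the signed sumset contains the ordinary
  \<open>h\<close>-fold sumset, and the latter gains at least \<open>card A - 1\<close> elements whenever \<open>h\<close> grows by one.
  For the symmetric interval, every signed sum is at most \<open>h * (k - 1) / 2\<close> in absolute value,
  which leaves room for exactly \<open>h * k - h + 1\<close> integers.
\<close>

definition fold_sumset :: "nat \<Rightarrow> int set \<Rightarrow> int set" where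
  "fold_sumset h A = {\<Sum>a\<in>A. int (c a) * a | c :: int \<Rightarrow> nat. (\<Sum>a\<in>A. c a) = h}"

lemma fold_sumset_subset_signed_sumset: "fold_sumset h A \<subseteq> signed_sumset h A"
proof
  fix x assume "x \<in> fold_sumset h A"
  then obtain c :: "int \<Rightarrow> nat" where x: "x = (\<Sum>a\<in>A. int (c a) * a)" and c: "(\<Sum>a\<in>A. c a) = h"
    by (auto simp: fold_sumset_def)
  have "(\<Sum>a\<in>A. \<bar>int (c a)\<bar>) = int h"
    using c by auto
  with x show "x \<in> signed_sumset h A"
    unfolding signed_sumset_def by (intro CollectI exI[of _ "\<lambda>a. int (c a)"]) simp
qed

text \<open>The triangle inequality bounds each term by \<open>\<bar>c a\<bar> * M\<close>, and the
  weights \<open>\<bar>c a\<bar>\<close> add up to \<open>h\<close>. It serves twice: for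
  finiteness, and for the upper bound in the extremal example.\<close>

lemma signed_sumset_bounded:
  assumes "\<And>a. a \<in> A \<Longrightarrow> \<bar>a\<bar> \<le> M"
  shows "signed_sumset h A \<subseteq> {- (int h * M) .. int h * M}"
proof
  fix x assume "x \<in> signed_sumset h A"
  then obtain c :: "int \<Rightarrow> int"
    where x: "x = (\<Sum>a\<in>A. c a * a)" and c: "(\<Sum>a\<in>A. \<bar>c a\<bar>) = int h"
    by (auto simp: signed_sumset_def)
  have "\<bar>x\<bar> \<le> (\<Sum>a\<in>A. \<bar>c a * a\<bar>)"
    unfolding x by (rule sum_abs)
  also have "\<dots> \<le> (\<Sum>a\<in>A. \<bar>c a\<bar> * M)"
    by (intro sum_mono) (simp add: abs_mult mult_left_mono assms)
  also have "\<dots> = int h * M"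
    using c by (simp flip: sum_distrib_right)
  finally show "x \<in> {- (int h * M) .. int h * M}" by auto
qed

lemma finite_signed_sumset:
  assumes "finite A"
  shows "finite (signed_sumset h A)"
proof (rule finite_subset[OF signed_sumset_bounded])
  \<comment> \<open>Any common bound on the absolute values will do; unlike a maximum, this sum is
    also meaningful for empty \<open>A\<close>.\<close>
  show "\<bar>a\<bar> \<le> (\<Sum>b\<in>A. \<bar>b\<bar>)" if "a \<in> A" for a
    using that assms by (intro member_le_sum) auto
qed simp

lemma card_set_plus_ge:
  fixes S T :: "'a::linordered_ab_group_add set"
  assumes "finite S" "finite T" "S \<noteq> {}" "T \<noteq> {}"
  shows "card S + card T \<le> card (S + T) + 1"
proof -
  \<comment> \<open>Two translates inside \<open>S + T\<close> that meet in a single point.\<close>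
  let ?U = "(\<lambda>s. s + Min T) ` S" and ?V = "(\<lambda>t. Max S + t) ` T"
  have "?U \<inter> ?V \<subseteq> {Max S + Min T}"
  proof
    fix x assume "x \<in> ?U \<inter> ?V"
    then obtain s t where "s \<in> S" "t \<in> T" "x = s + Min T" "x = Max S + t" by auto
    \<comment> \<open>Hence \<open>s + Min T \<le> Max S + Min T \<le> Max S + t\<close>; the two
      ends are both \<open>x\<close>, so equality holds throughout.\<close>
    moreover have "s \<le> Max S" "Min T \<le> t"
      using \<open>s \<in> S\<close> \<open>t \<in> T\<close> assms by auto
    ultimately show "x \<in> {Max S + Min T}"
      by (metis add_left_mono add_right_mono order_antisym singletonI)
  qed
  then have "card (?U \<inter> ?V) \<le> 1"
    using card_mono[of "{Max S + Min T}" "?U \<inter> ?V"] by simp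
  moreover have "card ?U = card S" "card ?V = card T"
    by (simp_all add: card_image inj_on_def)
  moreover have "card ?U + card ?V = card (?U \<union> ?V) + card (?U \<inter> ?V)"
    using assms by (intro card_Un_Int) auto
  moreover have "card (?U \<union> ?V) \<le> card (S + T)"
    using assms by (intro card_mono finite_set_plus) (auto intro!: set_plus_intro Min_in Max_in)
  ultimately show ?thesis by linarith
qed

text \<open>Adding an element \<open>b\<close> of \<open>A\<close> to a sum raises the coefficient
  of \<open>b\<close> by one.\<close>

lemma fold_sumset_plus_subset:
  assumes "finite A"
  shows "fold_sumset h A + A \<subseteq> fold_sumset (Suc h) A"
proof
  fix x assume "x \<in> fold_sumset h A + A"
  then obtain c :: "int \<Rightarrow> nat" and b
    where b: "b \<in> A" and x: "x = (\<Sum>a\<in>A. int (c a) * a) + b" and c: "(\<Sum>a\<in>A. c a) = h"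
    by (auto simp: fold_sumset_def elim!: set_plus_elim)
  let ?d = "\<lambda>a. c a + (if a = b then 1 else 0)"
  have "(\<Sum>a\<in>A. ?d a) = Suc h"
    using assms b c by (simp add: sum.distrib)
  \<comment> \<open>Isolating the extra unit as a separate summand lets the sum over it collapse to
    \<open>b\<close>.\<close>
  moreover have "(\<Sum>a\<in>A. int (?d a) * a) = (\<Sum>a\<in>A. int (c a) * a + (if a = b then a else 0))"
    by (rule sum.cong) (auto simp: algebra_simps)
  then have "(\<Sum>a\<in>A. int (?d a) * a) = x"
    using assms b x by (simp add: sum.distrib)
  ultimately show "x \<in> fold_sumset (Suc h) A"
    unfolding fold_sumset_def by (intro CollectI exI[of _ ?d]) simp
qed

text \<open>Induction on \<open>h\<close>: by \<open>card_set_plus_ge\<close>, each further copy of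
  \<open>A\<close> contributes at least \<open>card A - 1\<close> new elements, starting from the
  singleton \<open>{0}\<close>.\<close>

lemma card_fold_sumset_ge:
  assumes "finite A" "A \<noteq> {}"
  shows "h * (card A - 1) + 1 \<le> card (fold_sumset h A)"
proof (induction h)
  case 0
  have "fold_sumset 0 A = {0}"
    using assms by (auto simp: fold_sumset_def intro!: exI[of _ "\<lambda>_. 0"])
  then show ?case by simp
next
  case (Suc h)
  have fin: "finite (fold_sumset n A)" for n
    using finite_subset[OF fold_sumset_subset_signed_sumset finite_signed_sumset[OF assms(1)]] .
  \<comment> \<open>The \<open>+ 1\<close> in the induction hypothesis makes the cardinality
    positive.\<close>
  have "fold_sumset h A \<noteq> {}"
    using Suc by auto
  then have "card (fold_sumset h A) + card A \<le> card (fold_sumset h A + A) + 1"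
    using assms fin by (intro card_set_plus_ge)
  also have "card (fold_sumset h A + A) \<le> card (fold_sumset (Suc h) A)"
    using assms fin by (intro card_mono fold_sumset_plus_subset)
  finally have "card (fold_sumset h A) + card A \<le> card (fold_sumset (Suc h) A) + 1" by simp
  moreover have "card A \<ge> 1"
    using assms by (simp add: Suc_le_eq card_gt_0_iff)
  ultimately show ?case
    using Suc by simp
qed

lemma card_signed_sumset_ge:
  assumes "finite A" "A \<noteq> {}"
  shows "int (card (signed_sumset h A)) \<ge> int h * int (card A) - int h + 1"
proof -
  have "h * (card A - 1) + 1 \<le> card (signed_sumset h A)"
    using card_fold_sumset_ge[OF assms, of h]
      card_mono[OF finite_signed_sumset[OF assms(1)] fold_sumset_subset_signed_sumset, of h]
    by linarith
  \<comment> \<open>This makes the truncated subtraction \<open>card A - 1\<close> agree with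
    subtraction in the integers.\<close>
  moreover have "card A \<ge> 1"
    using assms by (simp add: Suc_le_eq card_gt_0_iff)
  then have "int (h * (card A - 1) + 1) = int h * int (card A) - int h + 1"
    by (simp add: of_nat_diff algebra_simps)
  ultimately show ?thesis by linarith
qed

text \<open>With \<open>k = 2 * m + 1\<close> elements, the general lower bound
  \<open>h * k - h + 1\<close> equals \<open>2 * h * m + 1\<close>, which is also the number of
  integers of absolute value at most \<open>h * m\<close>.\<close>

lemma card_signed_sumset_symmetric_interval:
  "int (card (signed_sumset h {- int m .. int m})) = 2 * int h * int m + 1"
proof (rule antisym)
  have "card (signed_sumset h {- int m .. int m}) \<le> card {- (int h * int m) .. int h * int m}"
    by (intro card_mono signed_sumset_bounded) auto
  then show "int (card (signed_sumset h {- int m .. int m})) \<le> 2 * int h * int m + 1"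
    by (simp add: nat_le_iff le_nat_iff mult.assoc)
  show "2 * int h * int m + 1 \<le> int (card (signed_sumset h {- int m .. int m}))"
    using card_signed_sumset_ge[of "{- int m .. int m}" h] by (simp add: algebra_simps)
qed

theorem theorem7:
  fixes h :: nat
  assumes "h \<ge> 1"
  shows "(\<forall>(A :: int set) (k :: nat).
            finite A \<and> card A = k \<and> (\<exists>a\<in>A. a > 0) \<and> (\<exists>a\<in>A. a < 0) \<longrightarrow>
            int (card (signed_sumset h A)) \<ge> int h * int k - int h + 1) \<and>
         (\<forall>k :: nat. odd k \<and> k \<ge> 3 \<longrightarrow>
            (let A = {- ((int k - 1) div 2) .. (int k - 1) div 2} in
               card A = k \<and> (\<exists>a\<in>A. a > 0) \<and> (\<exists>a\<in>A. a < 0) \<and>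
               int (card (signed_sumset h A)) = int h * int k - int h + 1))"
proof (intro conjI allI impI)
  fix A :: "int set" and k :: nat
  assume "finite A \<and> card A = k \<and> (\<exists>a\<in>A. a > 0) \<and> (\<exists>a\<in>A. a < 0)"
  then show "int (card (signed_sumset h A)) \<ge> int h * int k - int h + 1"
    using card_signed_sumset_ge[of A h] by auto
next
  fix k :: nat
  assume k: "odd k \<and> k \<ge> 3"
  then obtain m where m: "k = 2 * m + 1" by (auto elim: oddE)
  with k have "m \<ge> 1" by simp
  have half: "(int k - 1) div 2 = int m" using m by simp
  have "card {- int m .. int m} = k" using m by simp
  moreover have "\<exists>a\<in>{- int m .. int m}. a > 0" "\<exists>a\<in>{- int m .. int m}. a < 0"
    using \<open>m \<ge> 1\<close> by (auto intro: bexI[of _ "int m"] bexI[of _ "- int m"])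
  moreover have "int (card (signed_sumset h {- int m .. int m})) = int h * int k - int h + 1"
    using m by (simp add: card_signed_sumset_symmetric_interval algebra_simps)
  ultimately show "let A = {- ((int k - 1) div 2) .. (int k - 1) div 2} in
               card A = k \<and> (\<exists>a\<in>A. a > 0) \<and> (\<exists>a\<in>A. a < 0) \<and>
               int (card (signed_sumset h A)) = int h * int k - int h + 1"
    unfolding Let_def half by blast
qed

end
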